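(* Let $G=(A\cup B,E)$ be a marriage instance with critical set $C\subseteq A$, and let $G''$ be the instance constructed from $G$ as described in the context. For every dominant feasible matching $M$ of $G$ there exists a stable matching $M''$ of $G''$ such that $M$ is the image of $M''$, i.e. $M=\{(m,w): m\in A,\ w\in B,\ M''(m^i)=w\text{ for some copy } m^i \text{ of } m\}$.
   Context: A marriage instance is a bipartite graph $G=(A\cup B,E)$ ($A$ men, $B$ women) with strict preference lists; $\mathrm{Pref}(v)$ denotes the list of $v$; every vertex prefers being matched to being unmatched. A matching is stable if no edge $(a,b)$ outside it has both endpoints preferring each other to their current partners. For matchings $M,N$, $\phi(N,M)$ is the number of vertices preferring $N$ to $M$ (matched in $N$ but not in $M$, or matched in both and preferring the $N$-partner). A matching is feasible if it matches all of $C$; a popular feasible matching is a feasible $M$ with $\phi(N,M)\le\phi(M,N)$ for all feasible $N$; a dominant feasible matching is a popular feasible matching $M$ with $\phi(M,N)>\phi(N,M)$ for every feasible $N$ with $|N|>|M|$. Construction of $G''$: let $\ell=|C|$. For $m\in C$, $A''$ contains copies $m^0,\dots,m^{\ell+1}$ and $B''$ contains dummies $d_m^1,\dots,d_m^{\ell+1}$. For $m\in A\setminus C$, $A''$ contains copies $m^0,m^1$ and one dummy $d_m^1$. $B''$ also contains all of $B$. Preferences: for $m\in A\setminus C$: $m^0$: $\mathrm{Pref}(m)$ then $d_m^1$; $m^1$: $d_m^1$ then $\mathrm{Pref}(m)$. For $m\in C$: $m^0$: $\mathrm{Pref}(m)$ then $d_m^1$; $m^i$ ($1\le i\le\ell$):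 $d_m^i$, $\mathrm{Pref}(m)$, $d_m^{i+1}$; $m^{\ell+1}$: $d_m^{\ell+1}$ then $\mathrm{Pref}(m)$. For $w\in B$: the existing level-$(\ell+1)$ copies of the men of $\mathrm{Pref}(w)$ in the order of $\mathrm{Pref}(w)$, then the level-$\ell$ copies, and so on down to level $0$. For a dummy $d_m^i$: $m^{i-1}$ then $m^i$. *)

theory Defs
  imports Main
begin

record ('a, 'b) marriage =
  men :: "'a set"
  women :: "'b set"
  edges :: "('a \<times> 'b) set"
  prefM :: "'a \<Rightarrow> 'b list"
  prefW :: "'b \<Rightarrow> 'a list"

text \<open>Lists are ordered from most to least preferred and enumerate exactly the neighbours.
  Values of the preference functions outside the vertex sets are irrelevant.\<close>

definition marriage_instance :: "('a, 'b) marriage \<Rightarrow> bool" where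
  "marriage_instance G \<longleftrightarrow>
     finite (men G) \<and> finite (women G) \<and> edges G \<subseteq> men G \<times> women G \<and>
     (\<forall>m \<in> men G. distinct (prefM G m) \<and> set (prefM G m) = {w. (m, w) \<in> edges G}) \<and>
     (\<forall>w \<in> women G. distinct (prefW G w) \<and> set (prefW G w) = {m. (m, w) \<in> edges G})"

definition matching :: "('a, 'b) marriage \<Rightarrow> ('a \<times> 'b) set \<Rightarrow> bool" where
  "matching G M \<longleftrightarrow> M \<subseteq> edges G \<and>
     (\<forall>m w w'. (m, w) \<in> M \<longrightarrow> (m, w') \<in> M \<longrightarrow> w = w') \<and>
     (\<forall>m m' w. (m, w) \<in> M \<longrightarrow> (m', w) \<in> M \<longrightarrow> m = m')"

definition partnerM :: "('a \<times> 'b) set \<Rightarrow> 'a \<Rightarrow> 'b option" where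
  "partnerM M m = (if \<exists>w. (m, w) \<in> M then Some (THE w. (m, w) \<in> M) else None)"

definition partnerW :: "('a \<times> 'b) set \<Rightarrow> 'b \<Rightarrow> 'a option" where
  "partnerW M w = (if \<exists>m. (m, w) \<in> M then Some (THE m. (m, w) \<in> M) else None)"

definition before :: "'x list \<Rightarrow> 'x \<Rightarrow> 'x \<Rightarrow> bool" where
  "before xs x y \<longleftrightarrow> (\<exists>i j. i < j \<and> j < length xs \<and> xs ! i = x \<and> xs ! j = y)"

text \<open>\<open>prefers xs p q\<close>: a vertex with list \<open>xs\<close> strictly prefers the situation \<open>p\<close> to \<open>q\<close>,
  where \<open>None\<close> stands for being unmatched.\<close>

fun prefers :: "'x list \<Rightarrow> 'x option \<Rightarrow> 'x option \<Rightarrow> bool" where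
  "prefers xs (Some x) (Some y) \<longleftrightarrow> before xs x y"
| "prefers xs (Some x) None \<longleftrightarrow> True"
| "prefers xs None q \<longleftrightarrow> False"

definition stable_matching :: "('a, 'b) marriage \<Rightarrow> ('a \<times> 'b) set \<Rightarrow> bool" where
  "stable_matching G M \<longleftrightarrow> matching G M \<and>
     \<not> (\<exists>a b. (a, b) \<in> edges G - M \<and>
          prefers (prefM G a) (Some b) (partnerM M a) \<and>
          prefers (prefW G b) (Some a) (partnerW M b))"

definition phi :: "('a, 'b) marriage \<Rightarrow> ('a \<times> 'b) set \<Rightarrow> ('a \<times> 'b) set \<Rightarrow> nat" where
  "phi G N M =
     card {m \<in> men G. prefers (prefM G m) (partnerM N m) (partnerM M m)} +
     card {w \<in> women G. prefers (prefW G w) (partnerW N w) (partnerW M w)}"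

definition feasible :: "('a, 'b) marriage \<Rightarrow> 'a set \<Rightarrow> ('a \<times> 'b) set \<Rightarrow> bool" where
  "feasible G C M \<longleftrightarrow> matching G M \<and> (\<forall>m \<in> C. \<exists>w. (m, w) \<in> M)"

definition popular_feasible :: "('a, 'b) marriage \<Rightarrow> 'a set \<Rightarrow> ('a \<times> 'b) set \<Rightarrow> bool" where
  "popular_feasible G C M \<longleftrightarrow>
     feasible G C M \<and> (\<forall>N. feasible G C N \<longrightarrow> phi G N M \<le> phi G M N)"

definition dominant_feasible :: "('a, 'b) marriage \<Rightarrow> 'a set \<Rightarrow> ('a \<times> 'b) set \<Rightarrow> bool" where
  "dominant_feasible G C M \<longleftrightarrow>
     popular_feasible G C M \<and>
     (\<forall>N. feasible G C N \<longrightarrow> card N > card M \<longrightarrow> phi G M N > phi G N M)"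

text \<open>The men of \<open>G''\<close> are pairs \<open>(m, i)\<close>, read as the level-\<open>i\<close> copy of \<open>m\<close>.\<close>

datatype ('a, 'b) woman2 = Orig 'b | Dummy 'a nat

definition top_level :: "'a set \<Rightarrow> 'a \<Rightarrow> nat" where
  "top_level C m = (if m \<in> C then card C + 1 else 1)"

definition men2 :: "('a, 'b) marriage \<Rightarrow> 'a set \<Rightarrow> ('a \<times> nat) set" where
  "men2 G C = {(m, i). m \<in> men G \<and> i \<le> top_level C m}"

definition women2 :: "('a, 'b) marriage \<Rightarrow> 'a set \<Rightarrow> ('a, 'b) woman2 set" where
  "women2 G C = Orig ` women G \<union> {Dummy m i | m i. m \<in> men G \<and> 1 \<le> i \<and> i \<le> top_level C m}"

text \<open>One formula covers the lists of critical and non-critical men alike: a copy at level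
  \<open>i \<ge> 1\<close> starts with dummy \<open>i\<close>, and a copy below the top level ends with dummy \<open>i + 1\<close>.\<close>

definition prefM2 ::
  "('a, 'b) marriage \<Rightarrow> 'a set \<Rightarrow> 'a \<times> nat \<Rightarrow> ('a, 'b) woman2 list" where
  "prefM2 G C = (\<lambda>(m, i).
     (if 1 \<le> i then [Dummy m i] else []) @
     map Orig (prefM G m) @
     (if i < top_level C m then [Dummy m (i + 1)] else []))"

fun prefW2 ::
  "('a, 'b) marriage \<Rightarrow> 'a set \<Rightarrow> ('a, 'b) woman2 \<Rightarrow> ('a \<times> nat) list" where
  "prefW2 G C (Orig w) =
     concat (map (\<lambda>i. map (\<lambda>m. (m, i)) (filter (\<lambda>m. i \<le> top_level C m) (prefW G w)))
       (rev [0..<card C + 2]))"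
| "prefW2 G C (Dummy m i) = [(m, i - 1), (m, i)]"

definition G2 ::
  "('a, 'b) marriage \<Rightarrow> 'a set \<Rightarrow> ('a \<times> nat, ('a, 'b) woman2) marriage" where
  "G2 G C = \<lparr>
     men = men2 G C,
     women = women2 G C,
     edges = {(a, b). a \<in> men2 G C \<and> b \<in> set (prefM2 G C a)},
     prefM = prefM2 G C,
     prefW = prefW2 G C\<rparr>"

definition image_matching ::
  "('a, 'b) marriage \<Rightarrow> 'a set \<Rightarrow> (('a \<times> nat) \<times> ('a, 'b) woman2) set \<Rightarrow> ('a \<times> 'b) set" where
  "image_matching G C M2 =
     {(m, w). m \<in> men G \<and> w \<in> women G \<and>
        (\<exists>i. (m, i) \<in> men (G2 G C) \<and> ((m, i), Orig w) \<in> M2)}"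

lemma distinct_levels:
  assumes "distinct xs" "distinct is"
  shows "distinct (concat (map (\<lambda>i. map (\<lambda>m. (m, i :: nat)) (filter (P i) xs)) is))"
  using assms(2)
proof (induction "is")
  case Nil
  then show ?case by simp
next
  case (Cons i "is")
  then show ?case
    using assms(1) by (auto simp: distinct_map inj_on_def)
qed

lemma top_level_le: "top_level C m \<le> card C + 1"
  by (simp add: top_level_def)

lemma G2_marriage_instance:
  assumes G: "marriage_instance G"
  shows "marriage_instance (G2 G C)"
proof -
  have fin: "finite (men G)" "finite (women G)"
    and E: "edges G \<subseteq> men G \<times> women G"
    and PM: "\<And>m. m \<in> men G \<Longrightarrow> distinct (prefM G m) \<and> set (prefM G m) = {w. (m, w) \<in> edges G}"
    and PW: "\<And>w. w \<in> women G \<Longrightarrow> distinct (prefW G w) \<and> set (prefW G w) = {m. (m, w) \<in> edges G}"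
    using G by (auto simp: marriage_instance_def)
  have "men2 G C \<subseteq> men G \<times> {..card C + 1}"
    using top_level_le by (fastforce simp: men2_def intro: order_trans)
  then have f1: "finite (men2 G C)"
    using fin by (meson finite_SigmaI finite_atMost finite_subset)
  have "women2 G C \<subseteq> Orig ` women G \<union> (\<lambda>(m, i). Dummy m i) ` (men2 G C)"
    by (auto simp: women2_def men2_def image_iff)
  then have f2: "finite (women2 G C)"
    using fin f1 by (meson finite_UnI finite_imageI finite_subset)
  have e: "edges (G2 G C) \<subseteq> men2 G C \<times> women2 G C"
    using PM E by (auto simp: G2_def men2_def women2_def prefM2_def split: if_splits)
  have pm: "distinct (prefM2 G C a)" if "a \<in> men2 G C" for a
    using that PM by (auto simp: men2_def prefM2_def distinct_map inj_on_def)
  have pw: "distinct (prefW2 G C b) \<and> set (prefW2 G C b) = {a. (a, b) \<in> edges (G2 G C)}"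
    if b: "b \<in> women2 G C" for b
  proof (cases b)
    case (Orig w)
    then have w: "w \<in> women G"
      using b by (auto simp: women2_def)
    have "distinct (prefW2 G C b)"
      unfolding Orig prefW2.simps using PW[OF w] by (intro distinct_levels) auto
    moreover have "a \<in> set (prefW2 G C b) \<longleftrightarrow> (a, b) \<in> edges (G2 G C)" for a
    proof (cases a)
      case (Pair m i)
      have "i \<le> top_level C m \<Longrightarrow> i < card C + 2"
        using top_level_le[of C m] by linarith
      then show ?thesis
        using Pair Orig PW[OF w] PM[of m] E
        by (auto simp: G2_def men2_def prefM2_def image_iff simp del: upt_Suc)
    qed
    ultimately show ?thesis by blast
  next
    case (Dummy m i)
    then have "m \<in> men G" "1 \<le> i" "i \<le> top_level C m"
      using b by (auto simp: women2_def)
    then show ?thesis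
      using Dummy by (auto simp: G2_def men2_def prefM2_def)
  qed
  show ?thesis
    unfolding marriage_instance_def
    using f1 f2 e pm pw by (auto simp: G2_def)
qed

end

theory Submission
  imports Defs
begin

text \<open>Give an edge outside \<open>M\<close> the weight \<open>1\<close>, \<open>0\<close> or \<open>-1\<close> according to whether two, one or none
  of its endpoints prefer it to \<open>M\<close>. Putting each man \<open>m\<close> on a level \<open>f m\<close> and marrying his copy
  of that level to \<open>M(m)\<close>, the other copies to dummies, gives a stable matching as soon as
  \<open>f m + weight (m, w) \<le> f (M(w))\<close> for all edges \<open>(m, w)\<close> outside \<open>M\<close>, where \<open>f (M(w))\<close> is read as \<open>0\<close>
  for unmatched \<open>w\<close>, and \<open>f = 1\<close> on unmatched men. The least such \<open>f\<close> is given by heaviest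
  alternating paths. Switching \<open>M\<close> along a path or cycle changes the vote by twice its weight, up to
  the vertices left unmatched, so popularity excludes positive cycles and bounds \<open>f\<close> by \<open>1\<close> outside
  \<open>C\<close>, dominance handles paths joining two unmatched vertices, and a path can climb only one level
  per further man of \<open>C\<close>.\<close>

section \<open>Preference lists\<close>

lemma before_Nil [simp]: "\<not> before [] x y"
  by (simp add: before_def)

text \<open>Replaces the index-based definition by a recursion on the list, so that the facts on
  \<open>before\<close> below follow by short inductions.\<close>

lemma before_Cons [simp]:
  "before (z # xs) x y \<longleftrightarrow> z = x \<and> y \<in> set xs \<or> before xs x y"
proof
  assume "before (z # xs) x y"
  then obtain i j where ij: "i < j" "j < length (z # xs)" "(z # xs) ! i = x" "(z # xs) ! j = y"
    unfolding before_def by blast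
  then obtain j' where j': "j = Suc j'" by (cases j) auto
  show "z = x \<and> y \<in> set xs \<or> before xs x y"
  proof (cases i)
    case 0
    then show ?thesis using ij j' by auto
  next
    case (Suc i')
    then have "before xs x y" using ij j' unfolding before_def by auto
    then show ?thesis ..
  qed
next
  assume "z = x \<and> y \<in> set xs \<or> before xs x y"
  then show "before (z # xs) x y"
  proof
    assume "z = x \<and> y \<in> set xs"
    then obtain j where "j < length xs" "xs ! j = y" "z = x" by (auto simp: in_set_conv_nth)
    then show ?thesis unfolding before_def by (intro exI[of _ 0] exI[of _ "Suc j"]) auto
  next
    assume "before xs x y"
    then obtain i j where "i < j" "j < length xs" "xs ! i = x" "xs ! j = y"
      unfolding before_def by blast
    then show ?thesis unfolding before_def by (intro exI[of _ "Suc i"] exI[of _ "Suc j"]) auto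
  qed
qed

lemma before_append [simp]:
  "before (xs @ ys) x y \<longleftrightarrow> before xs x y \<or> before ys x y \<or> x \<in> set xs \<and> y \<in> set ys"
  by (induction xs) auto

lemma before_in_set: "before xs x y \<Longrightarrow> x \<in> set xs \<and> y \<in> set xs"
  by (induction xs) auto

lemma before_irrefl: "distinct xs \<Longrightarrow> \<not> before xs x x"
  by (induction xs) auto

lemma before_asym: "distinct xs \<Longrightarrow> before xs x y \<Longrightarrow> \<not> before xs y x"
  by (induction xs) (auto dest: before_in_set)

lemma before_total: "x \<in> set xs \<Longrightarrow> y \<in> set xs \<Longrightarrow> x \<noteq> y \<Longrightarrow> before xs x y \<or> before xs y x"
  by (induction xs) auto

lemma before_map: "before (map h xs) a b \<Longrightarrow> \<exists>x y. a = h x \<and> b = h y \<and> before xs x y"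
  by (induction xs) auto

lemma before_filter: "before (filter P xs) x y \<Longrightarrow> before xs x y"
  by (induction xs) (auto split: if_splits)

text \<open>Level \<open>n\<close> forms the first block of the list for \<open>Suc n\<close>, so
  each induction step only compares one new block with all lower ones.\<close>

lemma before_levels:
  assumes "before (concat (map (\<lambda>i. map (\<lambda>m. (m, i :: nat)) (filter (P i) xs)) (rev [0..<n]))) (m, i) (m', j)"
  shows "j < i \<or> i = j \<and> before xs m m'"
  using assms by (induction n) (auto dest!: before_map before_filter)

section \<open>Counting votes\<close>

lemma partnerM_Some: "single_valued M \<Longrightarrow> (v, x) \<in> M \<Longrightarrow> partnerM M v = Some x"
  unfolding partnerM_def single_valued_def by auto

lemma partnerM_None: "v \<notin> Domain M \<Longrightarrow> partnerM M v = None"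
  unfolding partnerM_def by auto

lemma partnerW_converse: "partnerW M w = partnerM (M\<inverse>) w"
  unfolding partnerM_def partnerW_def by simp

lemma matching_iff: "matching G M \<longleftrightarrow> M \<subseteq> edges G \<and> single_valued M \<and> single_valued (M\<inverse>)"
  unfolding matching_def single_valued_def by blast

text \<open>The vote of a vertex is charged to its edge in \<open>N - M\<close>; a vertex matched by
  \<open>M\<close> only has no such edge and contributes \<open>- 1\<close> separately. The side of
  the graph is left abstract, so that men are covered directly and women through converse
  relations.\<close>

lemma side_votes:
  assumes V: "finite V" "Domain N \<subseteq> V" "Domain M \<subseteq> V"
    and sv: "single_valued N" "single_valued M"
    and P: "\<And>v. v \<in> V \<Longrightarrow> distinct (P v)" "\<And>v x. (v, x) \<in> N \<union> M \<Longrightarrow> x \<in> set (P v)"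
    and fin: "finite N"
  shows "int (card {v \<in> V. prefers (P v) (partnerM N v) (partnerM M v)}) -
         int (card {v \<in> V. prefers (P v) (partnerM M v) (partnerM N v)}) =
         (\<Sum>e\<in>N - M. if prefers (P (fst e)) (Some (snd e)) (partnerM M (fst e)) then 1 else - 1) -
         int (card (Domain M - Domain N))"
proof -
  let ?g = "\<lambda>e. if prefers (P (fst e)) (Some (snd e)) (partnerM M (fst e)) then 1 else - 1 :: int"
  have count: "int (card {v \<in> V. Q v}) = (\<Sum>v\<in>V. of_bool (Q v))" for Q
    using V(1) by (simp add: Int_def)
  have single: "of_bool (prefers (P v) (partnerM N v) (partnerM M v)) -
      of_bool (prefers (P v) (partnerM M v) (partnerM N v)) =
      sum ?g {e \<in> N - M. fst e = v} - of_bool (v \<in> Domain M - Domain N)" if v: "v \<in> V" for v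
  proof (cases "v \<in> Domain N")
    case False
    then have *: "{e \<in> N - M. fst e = v} = {}" by auto
    show ?thesis
    proof (cases "v \<in> Domain M")
      case True
      then obtain x where "(v, x) \<in> M" by auto
      then show ?thesis unfolding * using False partnerM_Some[OF sv(2)] by (auto simp: partnerM_None)
    next
      case vM: False
      then show ?thesis unfolding * using False by (simp add: partnerM_None)
    qed
  next
    case True
    then obtain x where x: "(v, x) \<in> N" by auto
    note px = partnerM_Some[OF sv(1) x]
    show ?thesis
    proof (cases "(v, x) \<in> M")
      case xM: True
      then have *: "{e \<in> N - M. fst e = v} = {}" using x sv unfolding single_valued_def by auto
      show ?thesis
        unfolding * using True px partnerM_Some[OF sv(2) xM] before_irrefl[OF P(1)[OF v]] by simp
    next
      case xM: False
      then have *: "{e \<in> N - M. fst e = v} = {(v, x)}"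
        using x sv unfolding single_valued_def by auto
      show ?thesis
      proof (cases "v \<in> Domain M")
        case vM: True
        then obtain y where y: "(v, y) \<in> M" by auto
        then have "x \<noteq> y" using xM by auto
        \<comment> \<open>Distinct partners on a strict list are comparable, so this vote is
          \<open>1\<close> or \<open>- 1\<close>, never \<open>0\<close>.\<close>
        then have "before (P v) x y \<longleftrightarrow> \<not> before (P v) y x"
          using before_total before_asym P(1)[OF v] P(2) x y by (metis UnI1 UnI2)
        then show ?thesis unfolding * using True px partnerM_Some[OF sv(2) y] by auto
      next
        case vM: False
        then show ?thesis unfolding * using px by (simp add: partnerM_None)
      qed
    qed
  qed
  have "(\<Sum>v\<in>V. sum ?g {e \<in> N - M. fst e = v}) = sum ?g (N - M)"
    using V fin by (intro sum.group) (auto simp: Domain_fst)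
  moreover have "(\<Sum>v\<in>V. of_bool (v \<in> Domain M - Domain N)) = int (card (Domain M - Domain N))"
    using V by (subst count[symmetric]) (auto intro!: arg_cong[of _ _ card])
  ultimately show ?thesis
    unfolding count sum_subtractf[symmetric] by (simp add: single sum_subtractf)
qed

text \<open>Half of the total vote of the two endpoints of an edge outside \<open>M\<close> for that edge
  against their situation in \<open>M\<close>.\<close>

definition edge_weight :: "('a, 'b) marriage \<Rightarrow> ('a \<times> 'b) set \<Rightarrow> 'a \<times> 'b \<Rightarrow> int" where
  "edge_weight G M e =
     of_bool (prefers (prefM G (fst e)) (Some (snd e)) (partnerM M (fst e))) +
     of_bool (prefers (prefW G (snd e)) (Some (fst e)) (partnerW M (snd e))) - 1"

text \<open>The two endpoints of an edge of \<open>N - M\<close> each vote \<open>1\<close> or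
  \<open>- 1\<close>, together twice \<open>edge_weight\<close>. The only correction comes from
  vertices matched by \<open>M\<close> that \<open>N\<close> leaves unmatched.\<close>

lemma phi_difference:
  assumes G: "marriage_instance G" and "matching G N" "matching G M"
  shows "int (phi G N M) - int (phi G M N) =
    2 * sum (edge_weight G M) (N - M) -
    int (card (Domain M - Domain N)) - int (card (Range M - Range N))"
proof -
  have fin: "finite (men G)" "finite (women G)"
    and E: "edges G \<subseteq> men G \<times> women G"
    and PM: "\<And>m. m \<in> men G \<Longrightarrow> distinct (prefM G m) \<and> set (prefM G m) = {w. (m, w) \<in> edges G}"
    and PW: "\<And>w. w \<in> women G \<Longrightarrow> distinct (prefW G w) \<and> set (prefW G w) = {m. (m, w) \<in> edges G}"
    using G by (auto simp: marriage_instance_def)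
  have N: "N \<subseteq> edges G" "single_valued N" "single_valued (N\<inverse>)"
    and M: "M \<subseteq> edges G" "single_valued M" "single_valued (M\<inverse>)"
    using assms by (auto simp: matching_iff)
  have finN: "finite N"
    using fin E N(1) by (meson finite_SigmaI finite_subset)
  have lists: "w \<in> set (prefM G m)" "m \<in> set (prefW G w)" if "(m, w) \<in> N \<union> M" for m w
    using that PM PW E N(1) M(1) by blast+
  let ?f = "\<lambda>e. if prefers (prefM G (fst e)) (Some (snd e)) (partnerM M (fst e)) then 1 else - 1 :: int"
  let ?h = "\<lambda>e. if prefers (prefW G (fst e)) (Some (snd e)) (partnerW M (fst e)) then 1 else - 1 :: int"
  have men: "int (card {m \<in> men G. prefers (prefM G m) (partnerM N m) (partnerM M m)}) -
         int (card {m \<in> men G. prefers (prefM G m) (partnerM M m) (partnerM N m)}) =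
         sum ?f (N - M) - int (card (Domain M - Domain N))"
    using fin E PM N M finN by (intro side_votes lists) auto
  have women: "int (card {w \<in> women G. prefers (prefW G w) (partnerW N w) (partnerW M w)}) -
         int (card {w \<in> women G. prefers (prefW G w) (partnerW M w) (partnerW N w)}) =
         sum ?h (N\<inverse> - M\<inverse>) - int (card (Domain (M\<inverse>) - Domain (N\<inverse>)))"
    unfolding partnerW_converse using fin E PW N M finN by (intro side_votes) (auto intro: lists)
  have "N\<inverse> - M\<inverse> = prod.swap ` (N - M)" by force
  then have "sum ?h (N\<inverse> - M\<inverse>) = sum (\<lambda>e. ?h (prod.swap e)) (N - M)"
    by (simp add: sum.reindex)
  then have "sum ?f (N - M) + sum ?h (N\<inverse> - M\<inverse>) = sum (\<lambda>e. ?f e + ?h (prod.swap e)) (N - M)"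
    by (simp add: sum.distrib)
  also have "\<dots> = sum (\<lambda>e. 2 * edge_weight G M e) (N - M)"
    by (intro sum.cong) (auto simp: edge_weight_def)
  finally have "sum ?f (N - M) + sum ?h (N\<inverse> - M\<inverse>) = 2 * sum (edge_weight G M) (N - M)"
    by (simp add: sum_distrib_left)
  then show ?thesis
    unfolding phi_def using men women by simp
qed

section \<open>Alternating paths\<close>

locale dominant_feasible_matching =
  fixes G :: "('a, 'b) marriage" and C :: "'a set" and M :: "('a \<times> 'b) set"
  assumes inst: "marriage_instance G"
    and critical: "C \<subseteq> men G"
    and dominant: "dominant_feasible G C M"
begin

lemma finite_men: "finite (men G)"
  and edges_sub: "edges G \<subseteq> men G \<times> women G"
  and prefM: "m \<in> men G \<Longrightarrow> distinct (prefM G m) \<and> set (prefM G m) = {w. (m, w) \<in> edges G}"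
  using inst by (auto simp: marriage_instance_def)

lemma matching_M: "matching G M"
  and C_matched: "C \<subseteq> Domain M"
  and popular: "feasible G C N \<Longrightarrow> phi G N M \<le> phi G M N"
  and larger_loses: "feasible G C N \<Longrightarrow> card M < card N \<Longrightarrow> phi G N M < phi G M N"
  using dominant by (auto simp: dominant_feasible_def popular_feasible_def feasible_def)

lemma M_edges: "M \<subseteq> edges G" and sv: "single_valued M" and sv': "single_valued (M\<inverse>)"
  using matching_M by (auto simp: matching_iff)

definition mate :: "'a \<Rightarrow> 'b" where
  "mate m = the (partnerM M m)"

lemma mate_eq: "(m, w) \<in> M \<Longrightarrow> mate m = w"
  using partnerM_Some[OF sv] by (simp add: mate_def)

lemma mate_in: "m \<in> Domain M \<Longrightarrow> (m, mate m) \<in> M"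
  using mate_eq by blast

lemma mate_inj: "inj_on mate (Domain M)"
  using mate_in sv' by (metis converseI inj_onI single_valuedD)

abbreviation wt :: "'a \<times> 'b \<Rightarrow> int" where
  "wt \<equiv> edge_weight G M"

text \<open>An alternating path is given by its men; each man is followed by the \<open>M\<close>-partner of the
  next man.\<close>

definition steps :: "'a list \<Rightarrow> ('a \<times> 'b) list" where
  "steps ms = zip (butlast ms) (map mate (tl ms))"

text \<open>Only the first man may be unmatched, because every later man is reached through his
  partner.\<close>

definition path :: "'a list \<Rightarrow> bool" where
  "path ms \<longleftrightarrow> ms \<noteq> [] \<and> distinct ms \<and> set ms \<subseteq> men G \<and> set (tl ms) \<subseteq> Domain M \<and>
     set (steps ms) \<subseteq> edges G"

definition weight :: "'a list \<Rightarrow> int" where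
  "weight ms = sum_list (map wt (steps ms))"

lemma fst_steps: "map fst (steps ms) = butlast ms"
  and snd_steps: "map snd (steps ms) = map mate (tl ms)"
  by (auto simp: steps_def)

lemma steps_split: "steps (xs @ m # ys) = steps (xs @ [m]) @ steps (m # ys)"
proof -
  have "tl (xs @ m # ys) = tl (xs @ [m]) @ ys" by (cases xs) auto
  moreover have "length xs = length (tl (xs @ [m]))" by simp
  ultimately show ?thesis by (simp add: steps_def butlast_append del: length_tl)
qed

lemma steps_snoc: "xs \<noteq> [] \<Longrightarrow> steps (xs @ [m]) = steps xs @ [(last xs, mate m)]"
  using steps_split[of "butlast xs" "last xs" "[m]"]
  by (cases xs rule: rev_cases) (simp_all add: steps_def)

lemma weight_split: "weight (xs @ m # ys) = weight (xs @ [m]) + weight (m # ys)"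
  unfolding weight_def by (subst steps_split) simp

lemma weight_snoc: "xs \<noteq> [] \<Longrightarrow> weight (xs @ [m]) = weight xs + wt (last xs, mate m)"
  by (simp add: weight_def steps_snoc)

lemma path_prefix: "path (xs @ m # ys) \<Longrightarrow> path (xs @ [m])"
  unfolding path_def by (subst (asm) steps_split) (cases xs; auto)

lemma path_suffix: "path (xs @ m # ys) \<Longrightarrow> path (m # ys)"
  unfolding path_def by (subst (asm) steps_split) (cases xs; auto)

lemma path_singleton: "m \<in> men G \<Longrightarrow> path [m]"
  by (simp add: path_def steps_def)

lemma path_snoc:
  assumes "path xs" "m \<in> Domain M" "m \<notin> set xs" "(last xs, mate m) \<in> edges G"
  shows "path (xs @ [m])"
proof -
  have "m \<in> men G" using assms(2) M_edges edges_sub by auto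
  moreover have "xs \<noteq> []" using assms(1) by (simp add: path_def)
  ultimately show ?thesis using assms by (auto simp: path_def steps_snoc)
qed

text \<open>A step in \<open>M\<close> would lead from a man to his own partner, and injectivity of
  \<open>mate\<close> would identify him with the next man. Hence every step of a path counts as an
  edge outside \<open>M\<close>.\<close>

lemma steps_disjoint_M:
  assumes "path ms" shows "set (steps ms) \<inter> M = {}"
proof -
  have "(m, w) \<notin> M" if "(m, w) \<in> set (steps ms)" for m w
  proof
    assume mw: "(m, w) \<in> M"
    from that obtain i where i: "i < length (steps ms)" "steps ms ! i = (m, w)"
      by (auto simp: in_set_conv_nth)
    then have len: "Suc i < length ms" by (simp add: steps_def)
    have "m = ms ! i" "w = mate (ms ! Suc i)"
      using i len by (auto simp: steps_def nth_butlast nth_tl)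
    moreover have "ms ! Suc i \<in> set (tl ms)"
      using len nth_mem[of i "tl ms"] by (simp add: nth_tl)
    then have "ms ! Suc i \<in> Domain M" using assms by (auto simp: path_def)
    moreover have "m \<in> Domain M" using mw by auto
    ultimately have "ms ! i = ms ! Suc i"
      using mate_eq[OF mw] mate_inj by (metis inj_onD)
    then show False
      using assms len by (auto simp: path_def nth_eq_iff_index_eq)
  qed
  then show ?thesis by auto
qed

section \<open>Switching the matching along a path\<close>

definition switch :: "'a list \<Rightarrow> ('a \<times> 'b) set \<Rightarrow> ('a \<times> 'b) set" where
  "switch ms X = {e \<in> M. fst e \<notin> set ms} \<union> set (steps ms) \<union> X"

lemma Domain_steps: "Domain (set (steps ms)) = set (butlast ms)"
  by (metis Domain_fst fst_steps list.set_map)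

lemma Range_steps: "Range (set (steps ms)) = mate ` set (tl ms)"
  by (metis Range_snd snd_steps list.set_map)

lemma Domain_switch: "Domain (switch ms X) = (Domain M - set ms) \<union> set (butlast ms) \<union> Domain X"
  unfolding switch_def Domain_Un_eq Domain_steps by auto

lemma Range_switch: "Range (switch ms X) = mate ` (Domain M - set ms) \<union> mate ` set (tl ms) \<union> Range X"
proof -
  have "Range {e \<in> M. fst e \<notin> set ms} = mate ` (Domain M - set ms)"
    using mate_eq by (force simp: image_iff)
  then show ?thesis unfolding switch_def Range_Un_eq Range_steps by simp
qed

text \<open>\<open>X\<close> is empty or one final edge for the last man. By \<open>free\<close>,
  its woman is unmatched in \<open>M\<close> or is the partner released by the first man. Only the
  last man can lose his partner, so \<open>last\<close> is what keeps \<open>C\<close> matched. The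
  new edges are exactly the steps and \<open>X\<close>, and the vote is then read off from
  \<open>phi_difference\<close>.\<close>

lemma
  assumes p: "path ms"
    and X: "X \<subseteq> {(last ms, w)}" "X \<subseteq> edges G" "X \<inter> M = {}"
    and free: "Range X \<inter> mate ` (Domain M - {hd ms}) = {}"
    and last: "last ms \<in> C \<Longrightarrow> X \<noteq> {}"
  shows switch_feasible: "feasible G C (switch ms X)"
    and phi_switch: "int (phi G (switch ms X) M) - int (phi G M (switch ms X)) =
      2 * (weight ms + sum wt X) - int (card (Domain M - Domain (switch ms X))) -
      int (card (Range M - Range (switch ms X)))"
proof -
  let ?R = "{e \<in> M. fst e \<notin> set ms}" and ?S = "set (steps ms)"
  have ne: "ms \<noteq> []" and d: "distinct ms" and tlM: "set (tl ms) \<subseteq> Domain M"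
    using p by (auto simp: path_def)
  have sub: "set (butlast ms) \<subseteq> set ms" "set (tl ms) \<subseteq> set ms"
    using ne by (auto dest: in_set_butlastD list.set_sel(2))
  have ms: "set ms = insert (last ms) (set (butlast ms))" "last ms \<notin> set (butlast ms)"
    using ne d by (cases ms rule: rev_cases; simp)+
  have hd: "hd ms \<notin> set (tl ms)" using ne d by (cases ms) auto
  have dS: "distinct (map fst (steps ms))" "distinct (map snd (steps ms))"
    unfolding fst_steps snd_steps using d inj_on_subset[OF mate_inj tlM]
    by (auto simp: distinct_map distinct_butlast distinct_tl)
  have svS: "single_valued ?S" "single_valued (?S\<inverse>)"
    using dS unfolding single_valued_def distinct_map inj_on_def by fastforce+
  have svX: "single_valued X" "single_valued (X\<inverse>)"
    using X(1) by (auto simp: single_valued_def)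
  have svR: "single_valued ?R" "single_valued (?R\<inverse>)"
    using sv sv' by (auto simp: single_valued_def)
  have union: "single_valued (A \<union> B)"
    if "single_valued A" "single_valued B" "Domain A \<inter> Domain B = {}" for A B :: "('x \<times> 'y) set"
    using that unfolding single_valued_def by blast
  have RR: "Range ?R = mate ` (Domain M - set ms)"
    using mate_eq by (force simp: image_iff)
  \<comment> \<open>Injectivity of \<open>mate\<close> separates the women kept by men off the path
    from those passed along it.\<close>
  have mate_ne: "mate ` (Domain M - set ms) \<inter> mate ` set (tl ms) = {}"
    using mate_inj tlM sub unfolding inj_on_def by blast
  have "Domain ?R \<inter> Domain ?S = {}" unfolding Domain_steps using sub by auto
  moreover have "Domain (?R\<inverse>) \<inter> Domain (?S\<inverse>) = {}"
    unfolding Domain_converse RR Range_steps by (rule mate_ne)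
  ultimately have "single_valued (?R \<union> ?S)" "single_valued (?R\<inverse> \<union> ?S\<inverse>)"
    by (intro union svS svR; simp)+
  moreover have "Domain (?R \<union> ?S) \<inter> Domain X = {}"
    using X(1) ms ne Domain_steps[of ms] by (auto simp: Domain_Un_eq)
  moreover have "Domain (?R\<inverse> \<union> ?S\<inverse>) \<inter> Domain (X\<inverse>) = {}"
  proof -
    have "mate ` (Domain M - set ms) \<subseteq> mate ` (Domain M - {hd ms})"
      by (intro image_mono) (use ne in auto)
    then have "Range X \<inter> mate ` (Domain M - set ms) = {}" using free by blast
    moreover have "Range X \<inter> mate ` set (tl ms) = {}" using free tlM hd by blast
    ultimately show ?thesis
      unfolding Domain_Un_eq Domain_converse RR Range_steps by blast
  qed
  ultimately have "single_valued (switch ms X)" "single_valued ((switch ms X)\<inverse>)"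
    unfolding switch_def converse_Un by (auto intro!: union svX)
  moreover have "switch ms X \<subseteq> edges G"
    using p X M_edges by (auto simp: switch_def path_def)
  ultimately have m: "matching G (switch ms X)"
    by (simp add: matching_iff)
  have "C \<subseteq> Domain (switch ms X)"
    unfolding Domain_switch using C_matched ms(1) last X(1) by auto
  then show "feasible G C (switch ms X)"
    using m by (auto simp: feasible_def)
  have diff: "switch ms X - M = ?S \<union> X"
    using steps_disjoint_M[OF p] X(3) by (auto simp: switch_def)
  have "?S \<inter> X = {}" using X(1) ms(2) Domain_steps[of ms] by auto
  moreover have "finite X" using X(1) finite_subset by blast
  ultimately have "sum wt (switch ms X - M) = sum wt ?S + sum wt X"
    unfolding diff by (intro sum.union_disjoint) auto
  also have "sum wt ?S = weight ms"
    unfolding weight_def using dS(1) by (intro sum.distinct_set_conv_list) (simp add: distinct_map)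
  finally show "int (phi G (switch ms X) M) - int (phi G M (switch ms X)) =
      2 * (weight ms + sum wt X) - int (card (Domain M - Domain (switch ms X))) -
      int (card (Range M - Range (switch ms X)))"
    using phi_difference[OF inst m matching_M] by simp
qed

section \<open>Weight bounds from popularity and dominance\<close>

lemma Range_M: "Range M = mate ` Domain M"
  using mate_eq by (force simp: image_iff)

lemma lost_men: "Domain M - Domain (switch ms X) \<subseteq> {last ms} \<inter> Domain M - Domain X"
  by (cases ms rule: rev_cases) (auto simp: Domain_switch)

text \<open>Every man after the first hands his partner to the man before him, so only the first
  man's partner can be abandoned.\<close>

lemma lost_women: "Range M - Range (switch ms X) \<subseteq> mate ` ({hd ms} \<inter> Domain M) - Range X"
proof -
  have "mate ` Domain M \<subseteq> mate ` ({hd ms} \<inter> Domain M) \<union> mate ` (Domain M - set ms) \<union> mate ` set (tl ms)"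
    by (cases ms) auto
  then show ?thesis unfolding Range_M Range_switch by blast
qed

text \<open>Switching along the closed cycle leaves nobody newly unmatched, so the vote is exactly
  twice the weight and popularity applies. The closing edge lies outside \<open>M\<close> because
  the first and last man differ.\<close>

lemma cycle_weight:
  assumes p: "path ms" and e: "(last ms, mate (hd ms)) \<in> edges G"
    and hd: "hd ms \<in> Domain M" "hd ms \<noteq> last ms"
  shows "weight ms + wt (last ms, mate (hd ms)) \<le> 0"
proof -
  let ?X = "{(last ms, mate (hd ms))}"
  have X: "?X \<inter> M = {}"
    using hd mate_inj mate_eq by (auto simp: inj_on_def) (metis DomainI)
  have free: "Range ?X \<inter> mate ` (Domain M - {hd ms}) = {}"
    using hd mate_inj unfolding inj_on_def by blast
  have
    "feasible G C (switch ms ?X)"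
    "int (phi G (switch ms ?X) M) - int (phi G M (switch ms ?X)) =
      2 * (weight ms + sum wt ?X) - int (card (Domain M - Domain (switch ms ?X))) -
      int (card (Range M - Range (switch ms ?X)))"
    using e by (intro switch_feasible[OF p _ _ X free] phi_switch[OF p _ _ X free]; simp)+
  moreover have "card (Domain M - Domain (switch ms ?X)) = 0" "card (Range M - Range (switch ms ?X)) = 0"
    using lost_men[of ms ?X] lost_women[of ms ?X] by (auto simp: card_eq_0_iff)
  ultimately show ?thesis
    using popular[of "switch ms ?X"] by simp
qed

text \<open>An unmatched man is placed at level 1, since in \<open>G''\<close> his dummy is taken by his level-0
  copy.\<close>

definition val :: "'a list \<Rightarrow> int" where
  "val ms = of_bool (hd ms \<notin> Domain M) + weight ms"

text \<open>A noncritical last man may be left unmatched. This costs at most his vote and, if the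
  first man is matched, that of the first man's partner. Popularity bounds twice the weight by
  \<open>2\<close> or \<open>1\<close> accordingly, and in the second case integrality gives weight
  at most \<open>0\<close>.\<close>

lemma val_noncritical:
  assumes p: "path ms" and "last ms \<notin> C"
  shows "val ms \<le> 1"
proof -
  let ?N = "switch ms {}"
  have "int (phi G ?N M) - int (phi G M ?N) =
      2 * weight ms - int (card (Domain M - Domain ?N)) - int (card (Range M - Range ?N))"
    using phi_switch[OF p, of "{}"] assms(2) by simp
  moreover have "phi G ?N M \<le> phi G M ?N"
    using switch_feasible[OF p, of "{}"] assms(2) by (intro popular) simp
  moreover have "card (Domain M - Domain ?N) \<le> card {last ms}"
    using lost_men[of ms "{}"] by (intro card_mono) auto
  moreover have "card (Range M - Range ?N) \<le> card (mate ` ({hd ms} \<inter> Domain M))"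
    using lost_women[of ms "{}"] by (intro card_mono) auto
  ultimately show ?thesis
    by (cases "hd ms \<in> Domain M") (auto simp: val_def)
qed

text \<open>If the first man is matched, at most his partner is lost, and integrality turns the
  bound \<open>1\<close> on twice the weight into weight at most \<open>0\<close>. If he is
  unmatched, the switch enlarges the matching, so dominance gives a strict loss and pays for the
  extra \<open>1\<close> in \<open>val\<close>.\<close>

lemma val_unmatched_woman:
  assumes p: "path ms" and e: "(last ms, w) \<in> edges G" and w: "w \<notin> Range M"
  shows "val ms + wt (last ms, w) \<le> 0"
proof -
  let ?X = "{(last ms, w)}"
  let ?N = "switch ms ?X"
  have X: "?X \<inter> M = {}" "Range ?X \<inter> mate ` (Domain M - {hd ms}) = {}"
    using w by auto (use w Range_M in blast)
  have feas: "feasible G C ?N"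
    using X e by (intro switch_feasible[OF p]) auto
  have phi: "int (phi G ?N M) - int (phi G M ?N) =
      2 * (weight ms + wt (last ms, w)) - int (card (Range M - Range ?N))"
  proof -
    have "card (Domain M - Domain ?N) = 0" using lost_men[of ms ?X] by (auto simp: card_eq_0_iff)
    then show ?thesis using phi_switch[OF p _ _ X] e by simp
  qed
  show ?thesis
  proof (cases "hd ms \<in> Domain M")
    case True
    have "card (Range M - Range ?N) \<le> card {mate (hd ms)}"
      using lost_women[of ms ?X] by (intro card_mono) auto
    then show ?thesis using True phi popular[OF feas] by (simp add: val_def)
  next
    case False
    then have "card (Range M - Range ?N) = 0" using lost_women[of ms ?X] by (auto simp: card_eq_0_iff)
    moreover have "phi G ?N M < phi G M ?N"
    proof (rule larger_loses[OF feas])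
      have N: "?N \<subseteq> edges G" "single_valued ?N"
        using feas by (auto simp: feasible_def matching_iff)
      have fin: "finite (edges G)"
        using inst edges_sub unfolding marriage_instance_def by (meson finite_SigmaI finite_subset)
      \<comment> \<open>Sizes are compared through the sets of matched men, where the gain of the
        first man is visible.\<close>
      have cardD: "card R = card (Domain R)" if "single_valued R" for R :: "('a \<times> 'b) set"
        unfolding Domain_fst using that
        by (intro card_image[symmetric]) (auto simp: inj_on_def single_valued_def)
      have "hd ms \<in> set ms" using p by (simp add: path_def)
      moreover have "Domain M - Domain ?N = {}" using lost_men[of ms ?X] by auto
      moreover have "set ms \<subseteq> Domain ?N"
        by (cases ms rule: rev_cases) (auto simp: Domain_switch)
      ultimately have "Domain M \<subset> Domain ?N" using False by auto
      moreover have "finite (Domain ?N)" using N(1) fin by (meson finite_Domain finite_subset)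
      ultimately show "card M < card ?N"
        using cardD[OF sv] cardD[OF N(2)] by (simp add: psubset_card_mono)
    qed
    ultimately show ?thesis using phi False by (simp add: val_def)
  qed
qed

section \<open>Heights of the men\<close>

lemma wt_le: "wt e \<le> 1"
  by (simp add: edge_weight_def)

text \<open>Appending a critical man raises the value by at most \<open>1\<close>, which his own
  contribution to the count absorbs. A path ending in a noncritical man is reset to at most
  \<open>1\<close> by \<open>val_noncritical\<close>, whatever precedes him.\<close>

lemma val_le:
  assumes "path ms"
  shows "val ms \<le> 1 + int (card (C \<inter> set ms))"
  using assms
proof (induction ms rule: rev_induct)
  case Nil
  then show ?case by (simp add: path_def)
next
  case (snoc m ns)
  show ?case
  proof (cases "m \<in> C")
    case False
    then show ?thesis using val_noncritical[OF snoc.prems] by simp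
  next
    case True
    show ?thesis
    proof (cases "ns = []")
      case True
      then show ?thesis by (simp add: val_def weight_def steps_def)
    next
      case ns: False
      have "path ns"
        using path_prefix[of "butlast ns" "last ns" "[m]"] snoc.prems ns
        by (cases ns rule: rev_cases) simp_all
      then have "val ns \<le> 1 + int (card (C \<inter> set ns))" by (rule snoc.IH)
      moreover have "val (ns @ [m]) \<le> val ns + 1"
        using ns wt_le by (simp add: val_def weight_snoc)
      moreover have "C \<inter> set (ns @ [m]) = insert m (C \<inter> set ns)" "m \<notin> set ns"
        using True snoc.prems by (auto simp: path_def)
      then have "card (C \<inter> set (ns @ [m])) = Suc (card (C \<inter> set ns))" by simp
      ultimately show ?thesis by simp
    qed
  qed
qed

text \<open>The maximum makes sense for every man: paths are distinct lists over a finite set, and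
  the one-man path is among them.\<close>

definition height :: "'a \<Rightarrow> int" where
  "height m = Max (val ` {ms. path ms \<and> last ms = m})"

lemma finite_paths: "finite {ms. path ms \<and> last ms = m}"
  by (rule finite_subset[OF _ finite_subset_distinct[OF finite_men]]) (auto simp: path_def)

lemma val_le_height: "path ms \<Longrightarrow> val ms \<le> height (last ms)"
  unfolding height_def using finite_paths by (intro Max_ge) auto

lemma height_attained:
  assumes "m \<in> men G"
  obtains ms where "path ms" "last ms = m" "height m = val ms"
proof -
  have "height m \<in> val ` {ms. path ms \<and> last ms = m}"
    unfolding height_def using finite_paths path_singleton[OF assms] by (intro Max_in) force+
  then show ?thesis using that by auto
qed

lemma height_ge: "m \<in> men G \<Longrightarrow> of_bool (m \<notin> Domain M) \<le> height m"
  using val_le_height[OF path_singleton] by (simp add: val_def weight_def steps_def)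

text \<open>Ensures that the copy chosen for each man exists: a path meets at most
  \<open>card C\<close> critical men, and \<open>card C + 1\<close> is the top level of a critical
  man.\<close>

lemma height_le:
  assumes "m \<in> men G" shows "height m \<le> int (top_level C m)"
proof -
  obtain ms where ms: "path ms" "last ms = m" "height m = val ms"
    using height_attained[OF assms] .
  have "card (C \<inter> set ms) \<le> card C"
    using finite_subset[OF critical finite_men] by (intro card_mono) auto
  then show ?thesis
    using val_le[OF ms(1)] val_noncritical[OF ms(1)] ms by (auto simp: top_level_def)
qed

lemma height_unmatched:
  assumes "m \<in> men G" "m \<notin> Domain M" shows "height m = 1" "top_level C m = 1"
proof -
  have "m \<notin> C" using assms C_matched by auto
  then show "top_level C m = 1" by (simp add: top_level_def)
  then show "height m = 1" using height_ge[of m] height_le[of m] assms by simp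
qed

lemma height_edge_unmatched:
  assumes "(m, w) \<in> edges G" "w \<notin> Range M"
  shows "height m + wt (m, w) \<le> 0"
proof -
  obtain ms where "path ms" "last ms = m" "height m = val ms"
    using height_attained assms edges_sub by blast
  then show ?thesis using val_unmatched_woman assms by auto
qed

text \<open>If the best path to \<open>m\<close> passes through \<open>m'\<close>, then closing it up there yields an alternating
  cycle, whose weight is nonpositive.\<close>

lemma height_edge:
  assumes e: "(m, w) \<in> edges G" and m': "(m', w) \<in> M" "m' \<noteq> m"
  shows "height m + wt (m, w) \<le> height m'"
proof -
  obtain ms where ms: "path ms" "last ms = m" "height m = val ms"
    using height_attained e edges_sub by blast
  have w: "mate m' = w" "m' \<in> Domain M" using mate_eq m' by auto
  show ?thesis
  proof (cases "m' \<in> set ms")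
    case False
    have ne: "ms \<noteq> []" using ms by (simp add: path_def)
    have "path (ms @ [m'])" using path_snoc[OF ms(1) w(2) False] ms w e by simp
    from val_le_height[OF this] show ?thesis
      using ms w ne by (simp add: val_def weight_snoc)
  next
    case True
    then obtain xs ys where s: "ms = xs @ m' # ys" by (auto dest: split_list)
    have "path (m' # ys)" "path (xs @ [m'])"
      using ms(1) path_prefix path_suffix unfolding s by blast+
    moreover have "last (m' # ys) = m" using ms(2) s by simp
    ultimately have "weight (m' # ys) + wt (m, w) \<le> 0" "val (xs @ [m']) \<le> height m'"
      using cycle_weight[of "m' # ys"] val_le_height[of "xs @ [m']"] w m' e by auto
    moreover have "val ms = val (xs @ [m']) + weight (m' # ys)"
      unfolding val_def s by (subst weight_split) (cases xs; simp)
    ultimately show ?thesis using ms by simp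
  qed
qed

section \<open>The stable matching\<close>

definition level :: "'a \<Rightarrow> nat" where
  "level m = nat (height m)"

lemma int_level: "m \<in> men G \<Longrightarrow> int (level m) = height m"
  using height_ge[of m] by (cases "m \<in> Domain M") (simp_all add: level_def)

lemma level_le: "m \<in> men G \<Longrightarrow> level m \<le> top_level C m"
  using height_le[of m] by (simp add: level_def)

text \<open>All dummies of \<open>m\<close> are used up: those up to \<open>level m\<close> get
  their first choice, the copy just below; each later one is the first choice of the copy it gets.
  Only the copy at \<open>level m\<close> remains for the partner in \<open>M\<close>.\<close>

definition lifted :: "(('a \<times> nat) \<times> ('a, 'b) woman2) set" where
  "lifted = {((m, level m), Orig w) | m w. (m, w) \<in> M} \<union>
     {((m, i), Dummy m (i + 1)) | m i. m \<in> men G \<and> i < level m} \<union>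
     {((m, i), Dummy m i) | m i. m \<in> men G \<and> level m < i \<and> i \<le> top_level C m}"

lemma lifted_Orig: "((m, i), Orig w) \<in> lifted \<longleftrightarrow> (m, w) \<in> M \<and> i = level m"
  by (auto simp: lifted_def)

lemma lifted_Dummy:
  "((m, i), Dummy m' j) \<in> lifted \<longleftrightarrow> m' = m \<and> m \<in> men G \<and>
     (i < level m \<and> j = i + 1 \<or> level m < i \<and> i \<le> top_level C m \<and> j = i)"
  by (auto simp: lifted_def)

lemma mem_edges2: "(a, b) \<in> edges (G2 G C) \<longleftrightarrow> a \<in> men2 G C \<and> b \<in> set (prefM2 G C a)"
  by (simp add: G2_def)

lemma lifted_edges: "lifted \<subseteq> edges (G2 G C)"
proof -
  have "(m, w) \<in> edges G \<and> m \<in> men G \<and> w \<in> set (prefM G m)" if "(m, w) \<in> M" for m w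
    using that M_edges edges_sub prefM by blast
  moreover have "i < top_level C m" if "m \<in> men G" "i < level m" for m i
    using that level_le[of m] by simp
  ultimately show ?thesis
    using level_le by (fastforce simp: lifted_def mem_edges2 men2_def prefM2_def)
qed

lemma lifted_matching: "matching (G2 G C) lifted"
  unfolding matching_iff
proof (intro conjI lifted_edges)
  show "single_valued lifted"
  proof (rule single_valuedI)
    fix a b b' assume "(a, b) \<in> lifted" "(a, b') \<in> lifted"
    then show "b = b'" using sv by (cases a; cases b; cases b')
        (auto simp: lifted_Orig lifted_Dummy single_valued_def)
  qed
  have inj: "m = m'" if "(m, w) \<in> M" "(m', w) \<in> M" for m m' w
    using that sv' by (auto simp: single_valued_def)
  show "single_valued (lifted\<inverse>)"
  proof (intro single_valuedI)
    fix b a a' assume "(b, a) \<in> lifted\<inverse>" "(b, a') \<in> lifted\<inverse>"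
    then have "(a, b) \<in> lifted" "(a', b) \<in> lifted" by auto
    then show "a = a'" by (cases b; cases a; cases a')
        (auto simp: lifted_Orig lifted_Dummy dest: inj)
  qed
qed

lemma partner_man: "(a, b) \<in> lifted \<Longrightarrow> partnerM lifted a = Some b"
  using lifted_matching by (auto simp: matching_iff intro: partnerM_Some)

lemma partner_woman: "(a, b) \<in> lifted \<Longrightarrow> partnerW lifted b = Some a"
  using lifted_matching unfolding partnerW_converse by (auto simp: matching_iff intro: partnerM_Some)

section \<open>Absence of blocking edges\<close>

lemma partner_Orig_None: "w \<notin> Range M \<Longrightarrow> partnerW M w = None"
  unfolding partnerW_converse by (rule partnerM_None) auto

text \<open>A dummy above \<open>level m\<close> could only be tempted by the copy one level lower.
  That copy either has its own dummy, its first choice, or is the chosen copy, which ranks the next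
  dummy below its original partner.\<close>

lemma lifted_dummy_not_blocking:
  assumes e: "((m, i), Dummy m' j) \<in> edges (G2 G C)"
    and "prefers (prefM2 G C (m, i)) (Some (Dummy m' j)) (partnerM lifted (m, i))"
    and "prefers (prefW2 G C (Dummy m' j)) (Some (m, i)) (partnerW lifted (Dummy m' j))"
  shows False
proof -
  have m: "m' = m" "m \<in> men G" "i \<le> top_level C m" and j: "1 \<le> j" "j \<le> top_level C m"
    and ij: "i = j \<or> i = j - 1"
    using e by (auto simp: mem_edges2 men2_def prefM2_def split: if_splits)
  have "level m < j"
  proof (rule ccontr)
    assume "\<not> level m < j"
    then have "((m, j - 1), Dummy m j) \<in> lifted" using m j by (auto simp: lifted_Dummy)
    from partner_woman[OF this] show False using assms(3) m j ij by auto
  qed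
  then have "((m, j), Dummy m j) \<in> lifted" using m j by (auto simp: lifted_Dummy)
  from partner_woman[OF this] have i: "i = j - 1" using assms(3) m j ij by auto
  show False
  proof (cases "i = level m")
    case False
    then have "((m, i), Dummy m i) \<in> lifted"
      using i \<open>level m < j\<close> m by (auto simp: lifted_Dummy)
    from partner_man[OF this] show False
      using assms(2) i j m prefM[of m] by (auto simp: prefM2_def dest!: before_in_set split: if_splits)
  next
    case True
    have "m \<in> Domain M"
    \<comment> \<open>An unmatched man has level \<open>1\<close>, which is also his top level, so
      there is no next dummy to move to.\<close>
    proof (rule ccontr)
      assume "m \<notin> Domain M"
      then show False using height_unmatched[of m] m j i True int_level[of m] by simp
    qed
    then obtain w where "(m, w) \<in> M" by auto
    then have "((m, i), Orig w) \<in> lifted" using True by (simp add: lifted_Orig)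
    from partner_man[OF this] show False
      using assms(2) i j m by (auto simp: prefM2_def dest!: before_in_set split: if_splits)
  qed
qed

text \<open>Copies above \<open>level m\<close> hold their first choice. For the others, blocking
  bounds the level of the partner of \<open>w\<close> by \<open>i - 1\<close> plus the vote of
  \<open>w\<close>, taken as \<open>0\<close> or \<open>1\<close>, while \<open>height_edge\<close>
  and \<open>wt_man\<close> force at least \<open>i\<close> plus that vote. If \<open>w\<close> is
  unmatched, \<open>height_edge_unmatched\<close> would force \<open>i + 1\<close> to be at most
  \<open>0\<close>.\<close>

lemma lifted_orig_not_blocking:
  assumes e: "((m, i), Orig w) \<in> edges (G2 G C)" and nM: "((m, i), Orig w) \<notin> lifted"
    and pm: "prefers (prefM2 G C (m, i)) (Some (Orig w)) (partnerM lifted (m, i))"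
    and pw: "prefers (prefW2 G C (Orig w)) (Some (m, i)) (partnerW lifted (Orig w))"
  shows False
proof -
  have m: "m \<in> men G" "i \<le> top_level C m" and w: "w \<in> set (prefM G m)"
    using e by (auto simp: mem_edges2 men2_def prefM2_def split: if_splits)
  then have mw: "(m, w) \<in> edges G" using prefM by auto
  have il: "i \<le> level m"
  proof (rule ccontr)
    assume "\<not> i \<le> level m"
    then have "((m, i), Dummy m i) \<in> lifted" using m by (auto simp: lifted_Dummy)
    from partner_man[OF this] show False
      using pm \<open>\<not> i \<le> level m\<close> by (auto simp: prefM2_def dest!: before_in_set split: if_splits)
  qed
  have man: "prefers (prefM G m) (Some w) (partnerM M m)" if "i = level m"
  proof (cases "m \<in> Domain M")
    case True
    then obtain x where x: "(m, x) \<in> M" by auto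
    then have "((m, i), Orig x) \<in> lifted" using that by (simp add: lifted_Orig)
    from partner_man[OF this] have "before (map (Orig :: 'b \<Rightarrow> ('a, 'b) woman2) (prefM G m)) (Orig w) (Orig x)"
      using pm by (auto simp: prefM2_def split: if_splits)
    then show ?thesis using partnerM_Some[OF sv x] by (auto dest: before_map)
  qed (simp add: partnerM_None)
  \<comment> \<open>A copy below \<open>level m\<close> has a dummy last on its list and so accepts
    any woman; the gap of at least one level makes up for the man's possibly missing vote.\<close>
  have wt_man: "int (level m) \<ge> int i + (if prefers (prefM G m) (Some w) (partnerM M m) then 0 else 1)"
    using il man by (cases "i = level m") auto
  show False
  proof (cases "w \<in> Range M")
    case False
    then have "wt (m, w) = of_bool (prefers (prefM G m) (Some w) (partnerM M m))"
      by (simp add: edge_weight_def partner_Orig_None)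
    then show False
      using height_edge_unmatched[OF mw False] wt_man int_level[OF m(1)]
      by (auto split: if_splits)
  next
    case True
    then obtain m' where m': "(m', w) \<in> M" by auto
    then have "((m', level m'), Orig w) \<in> lifted" by (simp add: lifted_Orig)
    from partner_woman[OF this]
    have "before (prefW2 G C (Orig w)) (m, i) (m', level m')" using pw by simp
    then have lev: "level m' < i \<or> i = level m' \<and> before (prefW G w) m m'"
      unfolding prefW2.simps by (rule before_levels)
    have pW: "partnerW M w = Some m'"
      using partnerM_Some[OF sv', of w m'] m' by (simp add: partnerW_converse)
    show False
    proof (cases "m' = m")
      case True
      \<comment> \<open>Here \<open>lev\<close> and \<open>il\<close> force
        \<open>i = level m\<close>, so the edge would already belong to
        \<open>lifted\<close>.\<close>
      then show False using lev il nM m' by (auto simp: lifted_Orig)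
    next
      case False
      have "m' \<in> men G" using m' M_edges edges_sub by auto
      then show False
        using height_edge[OF mw m' False] lev wt_man int_level[OF m(1)] int_level[of m'] pW
        by (cases "before (prefW G w) m m'") (auto simp: edge_weight_def split: if_splits)
    qed
  qed
qed

lemma lifted_stable: "stable_matching (G2 G C) lifted"
proof -
  have "False" if "(a, b) \<in> edges (G2 G C) - lifted"
    "prefers (prefM2 G C a) (Some b) (partnerM lifted a)"
    "prefers (prefW2 G C b) (Some a) (partnerW lifted b)" for a b
    using that lifted_dummy_not_blocking lifted_orig_not_blocking
    by (cases a; cases b) (metis DiffD1 DiffD2)+
  then show ?thesis
    using lifted_matching unfolding stable_matching_def by (auto simp: G2_def)
qed

lemma image_lifted: "image_matching G C lifted = M"
proof -
  have "m \<in> men G \<and> w \<in> women G" if "(m, w) \<in> M" for m w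
    using that M_edges edges_sub by blast
  then show ?thesis
    using level_le by (auto simp: image_matching_def lifted_Orig G2_def men2_def)
qed

end

theorem mainTheorem14:
  fixes G :: "('a, 'b) marriage" and C :: "'a set" and M :: "('a \<times> 'b) set"
  assumes "marriage_instance G"
    and "C \<subseteq> men G"
    and "dominant_feasible G C M"
  shows "\<exists>M2. stable_matching (G2 G C) M2 \<and> M = image_matching G C M2"
proof -
  interpret dominant_feasible_matching G C M
    using assms by unfold_locales
  show ?thesis
    using lifted_stable image_lifted by blast
qed

end
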